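(* Let $\mathcal{X},\mathcal{Y}$ be finite sets, $f:\mathcal{X}\times\mathcal{Y}\to\{0,1\}$, $n\ge 1$ an integer, and $k\ge 0$ a real number. If $f^{\oplus n}$ has a monochromatic rectangle of size $2^k$, then $f$ has a monochromatic rectangle of size at least $2^{k/n-2}$.
   Context: All logarithms are base $2$. $f^{\oplus n}:\mathcal{X}^n\times\mathcal{Y}^n\to\{0,1\}$ is defined by $f^{\oplus n}(x_1,\dots,x_n,y_1,\dots,y_n)=f(x_1,y_1)\oplus\cdots\oplus f(x_n,y_n)$, viewed as a function of $(x_1,\dots,x_n)\in\mathcal{X}^n$ and $(y_1,\dots,y_n)\in\mathcal{Y}^n$. A monochromatic rectangle of $g:\mathcal{A}\times\mathcal{B}\to\{0,1\}$ is a set $A\times B$ with $A\subseteq\mathcal{A}$, $B\subseteq\mathcal{B}$ on which $g$ is constant; its size is $|A|\cdot|B|$. *)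

theory Defs
  imports Complex_Main "HOL-Library.FuncSet" "HOL-Library.Z2"
begin

text \<open>Truth values \<open>{0,1}\<close> are elements of the two-element type \<^typ>\<open>bit\<close>, whose addition is
  exclusive or. The tuples in \<open>X\<^sup>n\<close> are the extensional functions on the index set \<open>{1..n}\<close>.\<close>

definition tuples :: "nat \<Rightarrow> 'a set \<Rightarrow> (nat \<Rightarrow> 'a) set"
  where "tuples n X = {1..n} \<rightarrow>\<^sub>E X"

definition xor_power :: "nat \<Rightarrow> ('a \<times> 'b \<Rightarrow> bit) \<Rightarrow> (nat \<Rightarrow> 'a) \<times> (nat \<Rightarrow> 'b) \<Rightarrow> bit"
  where "xor_power n f = (\<lambda>(x, y). \<Sum>i = 1..n. f (x i, y i))"

definition monochromatic_rectangle ::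
    "'a set \<Rightarrow> 'b set \<Rightarrow> ('a \<times> 'b \<Rightarrow> bit) \<Rightarrow> 'a set \<Rightarrow> 'b set \<Rightarrow> bool"
  where "monochromatic_rectangle \<A> \<B> g A B \<longleftrightarrow>
    A \<subseteq> \<A> \<and> B \<subseteq> \<B> \<and> (\<exists>c. \<forall>p \<in> A \<times> B. g p = c)"

end

theory Submission
  imports Defs
begin

text \<open>If every monochromatic rectangle of \<open>f\<close> has size at most \<open>M\<close>, then by induction every
  monochromatic rectangle \<open>A \<times> B\<close> of \<open>f\<^sup>\<oplus>\<^sup>n\<close> has size at most \<open>(4M)\<^sup>n\<close>. For the step, write
  \<open>f\<^sup>\<oplus>\<^sup>n\<close> as \<open>f(x,y) \<oplus> g(u,v)\<close>, and let \<open>A'\<close> be the projection of \<open>A\<close> to \<open>u\<close> and \<open>T\<close> the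
  projection of \<open>B\<close> to \<open>y\<close>. All \<open>x\<close> in a fixed fibre \<open>A\<^sub>u\<close> give the same row of \<open>f\<close> on \<open>T\<close>, and
  one of the two colours fills at least half of that row; so \<open>|A\<^sub>u| |T| \<le> 2M\<close>, hence
  \<open>|A| |T| \<le> 2M |A'|\<close>. For fixed \<open>y \<in> T\<close>, the colour of \<open>f(x,y)\<close> splits \<open>A'\<close> into two parts, each
  forming a monochromatic rectangle of \<open>g\<close> with \<open>B\<^sub>y\<close>; so \<open>|A'| |B| \<le> 2N |T|\<close>, where \<open>N\<close> is the
  bound for \<open>g\<close>. Multiplying the two estimates gives \<open>|A| |B| \<le> 4MN\<close>.\<close>


text \<open>\<open>A\<close> is the disjoint union of its fibres over the second coordinate, so the
  bound for one fibre is summed over the projection.\<close>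

lemma card_le_sum_fibres_snd:
  assumes "finite A" and "\<And>u. u \<in> snd ` A \<Longrightarrow> card {x. (x, u) \<in> A} * t \<le> m"
  shows "card A * t \<le> m * card (snd ` A)"
proof -
  have "card A = card (SIGMA u:snd ` A. {x. (x, u) \<in> A})"
    by (rule bij_betw_same_card[of prod.swap]) (force simp: bij_betw_def inj_on_def)
  also have "\<dots> = (\<Sum>u\<in>snd ` A. card {x. (x, u) \<in> A})"
  proof (rule card_SigmaI)
    have "{x. (x, u) \<in> A} \<subseteq> fst ` A" for u by force
    then show "\<forall>u\<in>snd ` A. finite {x. (x, u) \<in> A}"
      using assms(1) by (meson finite_imageI finite_subset)
  qed (use assms(1) in simp)
  finally have "card A * t = (\<Sum>u\<in>snd ` A. card {x. (x, u) \<in> A} * t)"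
    by (simp add: sum_distrib_right)
  also have "\<dots> \<le> (\<Sum>u\<in>snd ` A. m)"
    by (rule sum_mono) (rule assms(2))
  finally show ?thesis by (simp add: mult.commute)
qed

lemma monochromatic_rectangle_xor_bound:
  fixes f :: "'a \<times> 'b \<Rightarrow> bit" and g :: "'c \<times> 'd \<Rightarrow> bit"
  assumes fin: "finite A" "finite B"
    and sub: "A \<subseteq> X \<times> U" "B \<subseteq> Y \<times> V"
    and c: "\<And>x u y v. (x, u) \<in> A \<Longrightarrow> (y, v) \<in> B \<Longrightarrow> f (x, y) + g (u, v) = c"
    and M: "\<And>P Q. monochromatic_rectangle X Y f P Q \<Longrightarrow> card P * card Q \<le> M"
    and N: "\<And>P Q. monochromatic_rectangle U V g P Q \<Longrightarrow> card P * card Q \<le> N"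
  shows "card A * card B \<le> 4 * M * N"
proof (cases "A = {} \<or> B = {}")
  case False
  define A' where "A' = snd ` A"
  define T where "T = fst ` B"
  have finA': "finite A'" and finT: "finite T"
    using fin by (auto simp: A'_def T_def)
  have "card A * card T \<le> 2 * M * card A'"
    unfolding A'_def
  proof (rule card_le_sum_fibres_snd)
    fix u assume "u \<in> snd ` A"
    then obtain x0 where x0: "(x0, u) \<in> A" by auto
    let ?P = "{x. (x, u) \<in> A}"
    let ?T = "\<lambda>e. {y \<in> T. f (x0, y) = e}"
    \<comment> \<open>The same \<open>v\<close> serves \<open>x\<close> and \<open>x0\<close>, so
      the term \<open>g (u, v)\<close> cancels.\<close>
    have row: "f (x, y) = f (x0, y)" if "(x, u) \<in> A" "y \<in> T" for x y
    proof -
      from that(2) obtain v where v: "(y, v) \<in> B" unfolding T_def by auto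
      have "f (x, y) + g (u, v) = f (x0, y) + g (u, v)"
        using c[OF that(1) v] c[OF x0 v] by (rule trans[OF _ sym])
      then show ?thesis by (rule add_right_imp_eq)
    qed
    have "card ?P * card (?T e) \<le> M" for e
    proof (rule M)
      have "\<forall>p \<in> ?P \<times> ?T e. f p = e" using row by auto
      moreover have "?P \<subseteq> X" "?T e \<subseteq> Y" using sub by (auto simp: T_def)
      ultimately show "monochromatic_rectangle X Y f ?P (?T e)"
        unfolding monochromatic_rectangle_def by blast
    qed
    \<comment> \<open>Adding the bounds for both colours replaces choosing the more frequent
      one.\<close>
    from this[of 0] this[of 1] have "card ?P * (card (?T 0) + card (?T 1)) \<le> 2 * M"
      by (simp add: distrib_left)
    moreover have "T = ?T 0 \<union> ?T 1" by auto
    then have "card T \<le> card (?T 0) + card (?T 1)"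
      using card_Un_le by metis
    then have "card ?P * card T \<le> card ?P * (card (?T 0) + card (?T 1))"
      by (rule mult_left_mono) simp
    ultimately show "card ?P * card T \<le> 2 * M" by (rule order_trans[rotated])
  qed (rule fin)
  \<comment> \<open>Swapping lets the fibre lemma count \<open>B\<close> over its first coordinate,
    whose projection is \<open>T\<close>.\<close>
  moreover have "card (prod.swap ` B) * card A' \<le> 2 * N * card (snd ` prod.swap ` B)"
  proof (rule card_le_sum_fibres_snd)
    fix y
    have By: "{v. (v, y) \<in> prod.swap ` B} = {v. (y, v) \<in> B}"
      by simp
    let ?B = "{v. (y, v) \<in> B}"
    \<comment> \<open>Quantifying over \<open>x\<close> avoids choosing a preimage of
      \<open>u\<close>; that \<open>?A 0\<close> and \<open>?A 1\<close> cover \<open>A'\<close>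
      suffices for the count.\<close>
    let ?A = "\<lambda>e. {u. \<exists>x. (x, u) \<in> A \<and> f (x, y) = e}"
    have "card (?A e) * card ?B \<le> N" for e
    proof (rule N)
      have "g (u, v) = c - e" if "u \<in> ?A e" "v \<in> ?B" for u v
      proof -
        from that obtain x where "(x, u) \<in> A" "f (x, y) = e" "(y, v) \<in> B" by blast
        with c have "e + g (u, v) = c" by blast
        then show ?thesis by (metis add_diff_cancel_left')
      qed
      then have "\<forall>p \<in> ?A e \<times> ?B. g p = c - e" by auto
      moreover have "?A e \<subseteq> U" "?B \<subseteq> V" using sub by auto
      ultimately show "monochromatic_rectangle U V g (?A e) ?B"
        unfolding monochromatic_rectangle_def by blast
    qed
    from this[of 0] this[of 1] have "(card (?A 0) + card (?A 1)) * card ?B \<le> 2 * N"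
      by (simp add: distrib_right)
    moreover have "A' = ?A 0 \<union> ?A 1"
    proof -
      have "A' = {u. \<exists>x. (x, u) \<in> A \<and> (f (x, y) = 0 \<or> f (x, y) = 1)}"
        unfolding A'_def snd_eq_Range by auto
      then show ?thesis by blast
    qed
    then have "card A' \<le> card (?A 0) + card (?A 1)"
      using card_Un_le[of "?A 0" "?A 1"] by (simp only:)
    then have "card A' * card ?B \<le> (card (?A 0) + card (?A 1)) * card ?B"
      by (rule mult_right_mono) simp
    ultimately have "card A' * card ?B \<le> 2 * N"
      by (rule order_trans[rotated])
    then show "card {v. (v, y) \<in> prod.swap ` B} * card A' \<le> 2 * N"
      unfolding By by (simp add: mult.commute)
  qed (use fin in simp)
  then have "card B * card A' \<le> 2 * N * card T"
    by (simp add: T_def image_image card_image)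
  ultimately have "(card A * card T) * (card B * card A') \<le> (2 * M * card A') * (2 * N * card T)"
    by (rule mult_mono) auto
  then have "(card A * card B) * (card A' * card T) \<le> (4 * M * N) * (card A' * card T)"
    by (simp add: algebra_simps)
  \<comment> \<open>Nonemptiness of \<open>A\<close> and \<open>B\<close> permits cancelling this
    common factor.\<close>
  moreover have "card A' * card T > 0"
    using False finA' finT by (auto simp: card_gt_0_iff A'_def T_def)
  ultimately show ?thesis by (metis mult_le_cancel2)
qed auto

lemma tuples_Suc:
  "tuples (Suc n) X = (\<lambda>(x, u). u(Suc n := x)) ` (X \<times> tuples n X)"
  unfolding tuples_def by (simp add: atLeastAtMostSuc_conv PiE_insert_eq)

lemma inj_on_tuples_Suc:
  "inj_on (\<lambda>(x, u). u(Suc n := x)) (X \<times> tuples n X)"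
  unfolding tuples_def by (rule inj_combinator) simp

lemma xor_power_Suc:
  "xor_power (Suc n) f (u(Suc n := x), v(Suc n := y)) = f (x, y) + xor_power n f (u, v)"
  by (subst add.commute) (simp add: xor_power_def)

lemma card_monochromatic_rectangle_xor_power:
  fixes f :: "'a \<times> 'b \<Rightarrow> bit"
  assumes fin: "finite X" "finite Y"
    and M: "\<And>P Q. monochromatic_rectangle X Y f P Q \<Longrightarrow> card P * card Q \<le> M"
    and "monochromatic_rectangle (tuples n X) (tuples n Y) (xor_power n f) A B"
  shows "card A * card B \<le> (4 * M) ^ n"
  using assms(4)
proof (induction n arbitrary: A B)
  case 0
  \<comment> \<open>The only extensional function on the empty index set is constantly
    \<open>undefined\<close>.\<close>
  then have "A \<subseteq> {\<lambda>_. undefined}" "B \<subseteq> {\<lambda>_. undefined}"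
    by (auto simp: monochromatic_rectangle_def tuples_def)
  then have "card A \<le> 1" "card B \<le> 1"
    by (auto dest: card_mono[rotated])
  then show ?case
    using mult_le_mono by fastforce
next
  case (Suc n)
  let ?h = "\<lambda>(x, u). u(Suc n := x)"
  from Suc.prems obtain c where c: "\<And>p. p \<in> A \<times> B \<Longrightarrow> xor_power (Suc n) f p = c"
    unfolding monochromatic_rectangle_def by blast
  from Suc.prems have "A \<subseteq> tuples (Suc n) X" "B \<subseteq> tuples (Suc n) Y"
    by (auto simp: monochromatic_rectangle_def)
  then obtain A1 B1 where A1: "A1 \<subseteq> X \<times> tuples n X" "A = ?h ` A1"
    and B1: "B1 \<subseteq> Y \<times> tuples n Y" "B = ?h ` B1"
    unfolding tuples_Suc by (metis subset_imageE)
  have "finite (X \<times> tuples n X)" "finite (Y \<times> tuples n Y)"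
    using fin by (auto simp: tuples_def intro!: finite_PiE)
  then have "finite A1" "finite B1"
    using A1(1) B1(1) by (auto intro: finite_subset)
  \<comment> \<open>Here \<open>g\<close> is \<open>xor_power n f\<close>, and the induction
    hypothesis supplies \<open>N\<close> as \<open>(4 * M) ^ n\<close>.\<close>
  then have "card A1 * card B1 \<le> 4 * M * (4 * M) ^ n"
    using A1(1) B1(1) _ M Suc.IH
  proof (rule monochromatic_rectangle_xor_bound)
    fix x u y v assume "(x, u) \<in> A1" "(y, v) \<in> B1"
    then have "(u(Suc n := x), v(Suc n := y)) \<in> A \<times> B"
      using A1(2) B1(2) by force
    from c[OF this] show "f (x, y) + xor_power n f (u, v) = c"
      by (simp add: xor_power_Suc)
  qed
  moreover have "card A = card A1" "card B = card B1"
    unfolding A1(2) B1(2)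
    by (rule card_image, rule inj_on_subset, rule inj_on_tuples_Suc, fact)+
  ultimately show ?case by simp
qed

theorem theorem1p4:
  fixes X :: "'a set" and Y :: "'b set" and f :: "'a \<times> 'b \<Rightarrow> bit"
    and n :: nat and k :: real
  assumes "finite X" and "finite Y" and "n \<ge> 1" and "k \<ge> 0"
    and "\<exists>A B. monochromatic_rectangle (tuples n X) (tuples n Y) (xor_power n f) A B
           \<and> real (card A * card B) = 2 powr k"
  shows "\<exists>A B. monochromatic_rectangle X Y f A B
           \<and> real (card A * card B) \<ge> 2 powr (k / real n - 2)"
proof -
  let ?is_size = "\<lambda>m. \<exists>P Q. monochromatic_rectangle X Y f P Q \<and> m = card P * card Q"
  \<comment> \<open>A largest size \<open>M\<close> exists: the empty rectangle gives one size, and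
    all sizes are bounded.\<close>
  have "?is_size 0"
    by (rule exI[of _ "{}"], rule exI[of _ "{}"]) (simp add: monochromatic_rectangle_def)
  moreover have "\<forall>m. ?is_size m \<longrightarrow> m \<le> card X * card Y"
    using assms(1,2) by (auto simp: monochromatic_rectangle_def intro!: mult_le_mono card_mono)
  ultimately obtain M where M: "?is_size M" "\<forall>m. ?is_size m \<longrightarrow> m \<le> M"
    using ex_has_greatest_nat[of ?is_size 0 "\<lambda>m. m"] by (metis le_imp_less_Suc)
  from assms(5) obtain A B
    where AB: "monochromatic_rectangle (tuples n X) (tuples n Y) (xor_power n f) A B"
      and k: "real (card A * card B) = 2 powr k" by blast
  have "card A * card B \<le> (4 * M) ^ n"
    using card_monochromatic_rectangle_xor_power[OF assms(1,2) _ AB] M(2) by blast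
  then have "2 powr k \<le> (4 * real M) ^ n"
    unfolding k[symmetric] by (metis of_nat_le_iff of_nat_mult of_nat_numeral of_nat_power)
  moreover have "2 powr k = (2 powr (k / real n)) ^ n"
    using assms(3) by (simp add: powr_realpow[symmetric] powr_powr)
  \<comment> \<open>\<open>power_le_imp_le_base\<close> compares powers with a successor exponent,
    whence \<open>n - 1\<close>.\<close>
  ultimately have "2 powr (k / real n) \<le> 4 * real M"
    using assms(3) power_le_imp_le_base[of "2 powr (k / real n)" "n - 1" "4 * real M"] by simp
  then have "2 powr (k / real n - 2) \<le> real M"
    by (simp add: powr_diff)
  then show ?thesis using M(1) by blast
qed

end
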